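(* Let $D$ be a strong digraph of order $n$, and let $k$ be an integer with $2\le k\le n$. Then $$1\leq \kappa_k(D)\leq n-1 \qquad\text{and}\qquad 1\leq \lambda_k(D)\leq n-1.$$ Moreover, all of these bounds are sharp, and each upper bound is attained if and only if $D\cong \overleftrightarrow{K}_n$; that is, $\kappa_k(D)=n-1$ if and only if $D\cong\overleftrightarrow{K}_n$, and $\lambda_k(D)=n-1$ if and only if $D\cong\overleftrightarrow{K}_n$.
   Context: Digraphs are finite and have no parallel arcs or loops. A digraph is strong if for every ordered pair of vertices $x,y$ there is a directed path from $x$ to $y$. $\overleftrightarrow{K}_n$ is the complete digraph on $n$ vertices (both arcs $xy$ and $yx$ for every two distinct vertices). An out-tree is an oriented tree in which every vertex except one, called the root, has in-degree one. For $S\subseteq V(D)$ with $r\in S$ and $|S|\ge 2$, an $(S,r)$-tree is an out-tree $T$ in $D$ rooted at $r$ with $S\subseteq V(T)$. Two $(S,r)$-trees $T_1,T_2$ are arc-disjoint if $A(T_1)\cap A(T_2)=\emptyset$; two arc-disjoint $(S,r)$-trees are internally disjoint if moreover $V(T_1)\cap V(T_2)=S$. $\kappa_{S,r}(D)$ (respectively $\lambda_{S,r}(D)$) is the maximum number of pairwise internally disjoint (respectively pairwise arc-disjoint) $(S,r)$-trees in $D$. For $2\le k\le |V(D)|$, $\kappa_k(D)=\min\{\kappa_{S,r}(D)\mid S\subseteq V(D),\ |S|=k,\ r\in S\}$ and $\lambda_k(D)=\min\{\lambda_{S,r}(D)\mid S\subseteq V(D),\ |S|=k,\ r\in S\}$.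 A bound is sharp if there exist digraphs satisfying the hypotheses for which equality holds. *)

theory Defs
  imports "Graph_Theory.Graph_Theory"
begin

definition strong_digraph :: "('a,'b) pre_digraph \<Rightarrow> bool" where
  "strong_digraph D \<longleftrightarrow> digraph D \<and> strongly_connected D"

definition complete_dg :: "nat \<Rightarrow> (nat, nat \<times> nat) pre_digraph" where
  "complete_dg n = with_proj \<lparr> pverts = {0..<n}, parcs = {(u,v). u < n \<and> v < n \<and> u \<noteq> v} \<rparr>"

lemma complete_digraph_complete_dg: "complete_digraph n (complete_dg n)"
  unfolding complete_dg_def complete_digraph_pair_def by auto

text \<open>
  An oriented tree is an orientation of an undirected tree: there are no opposite arcs, and the
  underlying undirected graph is connected and has no cycle. Walks in \<^const>\<open>mk_symmetric\<close> may
  traverse an edge back and forth, so the cycles of the undirected graph are the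
  \<^const>\<open>pre_digraph.cycle\<close>s of length at least 3. (The library's \<^const>\<open>tree\<close> only excludes
  directed cycles, hence is not the notion needed here.)
\<close>
definition oriented_tree :: "('a,'b) pre_digraph \<Rightarrow> bool" where
  "oriented_tree T \<longleftrightarrow>
     digraph T \<and>
     (\<forall>u v. u \<rightarrow>\<^bsub>T\<^esub> v \<longrightarrow> \<not> v \<rightarrow>\<^bsub>T\<^esub> u) \<and>
     connected T \<and>
     \<not> (\<exists>p. pre_digraph.cycle (with_proj (mk_symmetric T)) p \<and> 3 \<le> length p)"

definition out_tree :: "('a,'b) pre_digraph \<Rightarrow> 'a \<Rightarrow> bool" where
  "out_tree T r \<longleftrightarrow>
     oriented_tree T \<and> r \<in> verts T \<and> (\<forall>v \<in> verts T. in_degree T v = 1 \<longleftrightarrow> v \<noteq> r)"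

definition Sr_tree :: "('a,'b) pre_digraph \<Rightarrow> 'a set \<Rightarrow> 'a \<Rightarrow> ('a,'b) pre_digraph \<Rightarrow> bool" where
  "Sr_tree D S r T \<longleftrightarrow> out_tree T r \<and> subgraph T D \<and> S \<subseteq> verts T"

definition arc_disjoint :: "('a,'b) pre_digraph \<Rightarrow> ('a,'b) pre_digraph \<Rightarrow> bool" where
  "arc_disjoint T1 T2 \<longleftrightarrow> arcs T1 \<inter> arcs T2 = {}"

definition internally_disjoint ::
    "'a set \<Rightarrow> ('a,'b) pre_digraph \<Rightarrow> ('a,'b) pre_digraph \<Rightarrow> bool" where
  "internally_disjoint S T1 T2 \<longleftrightarrow> arc_disjoint T1 T2 \<and> verts T1 \<inter> verts T2 = S"

text \<open>
  A subgraph shares the functions \<^const>\<open>tail\<close> and \<^const>\<open>head\<close> with the ambient digraph, so distinct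
  members of the families below differ in their vertices or arcs, and the set of cardinalities is
  finite and contains 0. No tree is lost by using sets instead of indexed families, because
  for \<^term>\<open>2 \<le> card S\<close> an \<open>(S,r)\<close>-tree has an arc and so is not arc-disjoint from itself.
\<close>
definition kappa_Sr :: "('a,'b) pre_digraph \<Rightarrow> 'a set \<Rightarrow> 'a \<Rightarrow> nat" where
  "kappa_Sr D S r =
     Max {card F | F. F \<subseteq> {T. Sr_tree D S r T} \<and> pairwise (internally_disjoint S) F}"

definition lambda_Sr :: "('a,'b) pre_digraph \<Rightarrow> 'a set \<Rightarrow> 'a \<Rightarrow> nat" where
  "lambda_Sr D S r =
     Max {card F | F. F \<subseteq> {T. Sr_tree D S r T} \<and> pairwise arc_disjoint F}"

definition kappa :: "nat \<Rightarrow> ('a,'b) pre_digraph \<Rightarrow> nat" where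
  "kappa k D = Min {kappa_Sr D S r | S r. S \<subseteq> verts D \<and> card S = k \<and> r \<in> S}"

definition lambda :: "nat \<Rightarrow> ('a,'b) pre_digraph \<Rightarrow> nat" where
  "lambda k D = Min {lambda_Sr D S r | S r. S \<subseteq> verts D \<and> card S = k \<and> r \<in> S}"

end

theory Submission
  imports Defs
begin

text \<open>
  Every \<open>(S,r)\<close>-tree enters each \<open>s \<in> S\<close> with \<open>s \<noteq> r\<close> by an arc, and arc-disjoint trees enter it by
  different arcs. Hence \<open>\<lambda>\<^bsub>S,r\<^esub>(D)\<close> is at most the in-degree of \<open>s\<close> (\<open>lambda_Sr_le_in_degree\<close>).
  As \<open>k \<ge> 2\<close>, every vertex \<open>s\<close> is a non-root terminal for some choice of \<open>S\<close> and \<open>r\<close>, so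
  \<open>\<lambda>\<^sub>k(D)\<close> is at most the minimum in-degree, which is at most \<open>n - 1\<close>; and if \<open>\<lambda>\<^sub>k(D) = n - 1\<close>, then
  every in-degree is \<open>n - 1\<close> and \<open>D\<close> is complete. Since internally disjoint trees are
  arc-disjoint, \<open>\<kappa>\<^sub>k(D) \<le> \<lambda>\<^sub>k(D)\<close>, and everything said about large values carries over to \<open>\<kappa>\<^sub>k\<close>.

  Conversely, the complete digraph has \<open>n - 1\<close> internally disjoint \<open>(S,r)\<close>-trees, one for each
  vertex \<open>c \<noteq> r\<close>: go from \<open>r\<close> to \<open>c\<close>, and from \<open>c\<close> to all remaining vertices of \<open>S\<close>
  (\<open>kappa_Sr_complete\<close>).

  For the lower bound, a breadth-first search tree from \<open>r\<close> in a strong digraph is an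
  \<open>(S,r)\<close>-tree (\<open>ex_Sr_tree\<close>). The bidirected star attains the lower bounds, since its leaves have
  in-degree 1.

  Both constructions choose for each vertex other than \<open>r\<close> an arc entering it, along which some
  rank increases. That such a choice always gives an out-tree in the sense of an oriented
  undirected tree is \<open>Sr_tree_parent_graph\<close>; acyclicity is the part that takes an argument.
\<close>

section \<open>Out-trees from parent arcs\<close>

lemma (in pre_digraph) closed_walk_consecutive:
  assumes "cas u p u" "i < length p"
  shows "tail G (p ! (Suc i mod length p)) = head G (p ! i)"
proof -
  have ne: "p \<noteq> []" using assms by auto
  have "map (tail G) p @ [head G (last p)] = tail G (hd p) # map (head G) p"
    using awalk_verts_conv[of u p] awalk_verts_conv'[OF assms(1)] ne by simp
  then have step: "(map (tail G) p @ [head G (last p)]) ! Suc i = head G (p ! i)"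
    using assms(2) by simp
  show ?thesis
  proof (cases "Suc i < length p")
    case True
    then show ?thesis using step by (simp add: nth_append)
  next
    case False
    then have l: "Suc i = length p" using assms(2) by simp
    have hd: "tail G (hd p) = u" using assms(1) ne by (simp add: cas_simp)
    have "cas x q y \<Longrightarrow> awlast x q = y" for x q y
      by (induct q arbitrary: x) auto
    then have "awlast u p = u" using assms(1) .
    then have "head G (last p) = u" using ne by (simp add: awalk_verts_conv)
    then show ?thesis using l hd ne step by (simp add: nth_append hd_conv_nth)
  qed
qed

text \<open>
  Consider a vertex of maximal rank on the cycle. The arcs joining it to its two neighbours on the
  cycle go up in rank, so both enter it. By injectivity of \<^const>\<open>head\<close> they are the same arc, so
  the two neighbours coincide, which on a cycle is possible only for length at most 2.
\<close>
lemma no_long_cycle_of_rank: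
  fixes d :: "'a \<Rightarrow> nat"
  assumes rank: "\<And>a. a \<in> arcs T \<Longrightarrow> d (tail T a) < d (head T a)"
    and inj: "inj_on (head T) (arcs T)"
    and cyc: "pre_digraph.cycle (with_proj (mk_symmetric T)) p"
  shows "length p < 3"
proof (rule ccontr)
  assume "\<not> length p < 3"
  then have len: "3 \<le> length p" by simp
  define m where "m = length p"
  have m3: "3 \<le> m" using len by (simp add: m_def)
  obtain u where w: "pre_digraph.awalk (with_proj (mk_symmetric T)) u p u"
    and dist: "distinct (tl (pre_digraph.awalk_verts (with_proj (mk_symmetric T)) u p))"
    using cyc by (auto simp: pre_digraph.cycle_def)
  have cas: "pre_digraph.cas (with_proj (mk_symmetric T)) u p u"
    and sub: "set p \<subseteq> parcs (mk_symmetric T)"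
    using w by (auto simp: pre_digraph.awalk_def)
  have ne: "p \<noteq> []" using len by auto
  have dist': "distinct (map snd p)"
    using dist pre_digraph.awalk_verts_conv'[OF cas] ne by simp
  have cons: "fst (p ! (Suc i mod m)) = snd (p ! i)" if "i < m" for i
    using pre_digraph.closed_walk_consecutive[OF cas, of i] that by (simp add: m_def)
  have parent: "\<exists>a \<in> arcs T. tail T a = x \<and> head T a = y"
    if xy: "(x, y) \<in> parcs (mk_symmetric T) \<or> (y, x) \<in> parcs (mk_symmetric T)"
      and le: "d x \<le> d y" for x y
  proof -
    obtain a where "a \<in> arcs T" "tail T a = x \<and> head T a = y \<or> tail T a = y \<and> head T a = x"
      using xy unfolding parcs_mk_symmetric by blast
    then show ?thesis using rank[of a] le by auto
  qed
  define M where "M = Max ((\<lambda>a. d (snd a)) ` set p)"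
  have "M \<in> (\<lambda>a. d (snd a)) ` set p" unfolding M_def using ne by (intro Max_in) auto
  then obtain j where j: "j < m" "d (snd (p ! j)) = M" by (auto simp: in_set_conv_nth m_def)
  have top: "d (snd (p ! i)) \<le> d (snd (p ! j))" if "i < m" for i
    unfolding j(2) M_def using that by (intro Max_ge) (auto simp: m_def)
  \<comment> \<open>Entry \<open>j\<close> of \<open>p\<close> ends at the topmost vertex, so its cyclic neighbours are the ends of
    entries \<open>i\<close> and \<open>k\<close>, and \<open>3 \<le> m\<close> makes these indices differ.\<close>
  define i where "i = (if j = 0 then m - 1 else j - 1)"
  define k where "k = Suc j mod m"
  have i: "i < m" "Suc i mod m = j" using j m3 by (auto simp: i_def)
  have k: "k < m" using m3 by (simp add: k_def)
  have neq: "i \<noteq> k"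
    using j m3 by (cases "Suc j < m") (auto simp: i_def k_def le_less_Suc_eq dest: Suc_lessI split: if_splits)
  have "p ! j \<in> parcs (mk_symmetric T)" "p ! k \<in> parcs (mk_symmetric T)"
    using sub j k by (auto simp: m_def)
  moreover have "p ! j = (snd (p ! i), snd (p ! j))" "p ! k = (snd (p ! j), snd (p ! k))"
    using cons[of i] cons[of j] i j by (auto simp: k_def prod_eq_iff)
  ultimately have edges: "(snd (p ! i), snd (p ! j)) \<in> parcs (mk_symmetric T)"
    "(snd (p ! j), snd (p ! k)) \<in> parcs (mk_symmetric T)"
    by simp_all
  obtain a where a: "a \<in> arcs T" "tail T a = snd (p ! i)" "head T a = snd (p ! j)"
    using parent[OF disjI1[OF edges(1)] top[OF i(1)]] by blast
  obtain b where b: "b \<in> arcs T" "tail T b = snd (p ! k)" "head T b = snd (p ! j)"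
    using parent[OF disjI2[OF edges(2)] top[OF k]] by blast
  have "a = b" using a b by (intro inj_onD[OF inj]) simp_all
  then have "snd (p ! i) = snd (p ! k)" using a b by simp
  then show False using dist' neq i k by (simp add: distinct_conv_nth m_def)
qed

definition parent_graph ::
    "('a,'b) pre_digraph \<Rightarrow> 'a set \<Rightarrow> 'a \<Rightarrow> ('a \<Rightarrow> 'b) \<Rightarrow> ('a,'b) pre_digraph" where
  "parent_graph D V r e =
     \<lparr> verts = V, arcs = e ` (V - {r}), tail = tail D, head = head D \<rparr>"

lemma parent_graph_simps [simp]:
  "verts (parent_graph D V r e) = V" "arcs (parent_graph D V r e) = e ` (V - {r})"
  "tail (parent_graph D V r e) = tail D" "head (parent_graph D V r e) = head D"
  by (simp_all add: parent_graph_def)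

text \<open>
  The rank \<open>d\<close> serves twice: following parent arcs down from a vertex must end in \<open>r\<close>, which gives
  connectedness, and no undirected cycle has a topmost vertex.
\<close>
lemma Sr_tree_parent_graph:
  fixes d :: "'a \<Rightarrow> nat"
  assumes D: "digraph D"
    and V: "V \<subseteq> verts D" "r \<in> V" "S \<subseteq> V"
    and e: "\<And>v. v \<in> V \<Longrightarrow> v \<noteq> r \<Longrightarrow>
      e v \<in> arcs D \<and> head D (e v) = v \<and> tail D (e v) \<in> V \<and> d (tail D (e v)) < d v"
  shows "Sr_tree D S r (parent_graph D V r e)"
proof -
  let ?T = "parent_graph D V r e"
  interpret D: digraph D by (rule D)
  have fin: "finite V" using V(1) D.finite_verts by (rule finite_subset)
  have arc: "a \<in> arcs D" "head D a \<in> V" "head D a \<noteq> r" "tail D a \<in> V"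
      "d (tail D a) < d (head D a)" "a = e (head D a)"
    if a: "a \<in> arcs ?T" for a
  proof -
    obtain v where "v \<in> V" "v \<noteq> r" "a = e v" using a by auto
    with e[of v] show "a \<in> arcs D" "head D a \<in> V" "head D a \<noteq> r" "tail D a \<in> V"
      "d (tail D a) < d (head D a)" "a = e (head D a)" by auto
  qed
  interpret T: digraph ?T
  proof unfold_locales
    fix a assume "a \<in> arcs ?T"
    then show "tail ?T a \<noteq> head ?T a" using arc(1)[of a] D.no_loops by simp
  next
    fix a b assume "a \<in> arcs ?T" "b \<in> arcs ?T" "arc_to_ends ?T a = arc_to_ends ?T b"
    then show "a = b"
      using arc(1)[of a] arc(1)[of b] D.no_multi_arcs[of a b] by (simp add: arc_to_ends_def)
  next
    fix a assume a: "a \<in> arcs ?T"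
    show "tail ?T a \<in> verts ?T" "head ?T a \<in> verts ?T" using arc(2,4)[OF a] by simp_all
  qed (simp_all add: fin)
  have rank: "d (tail ?T a) < d (head ?T a)" if "a \<in> arcs ?T" for a
    using arc(5)[OF that] by simp
  have "inj_on (head ?T) (arcs ?T)"
  proof (rule inj_onI)
    fix a b assume "a \<in> arcs ?T" "b \<in> arcs ?T" "head ?T a = head ?T b"
    then show "a = b" using arc(6)[of a] arc(6)[of b] by simp
  qed
  then have nocyc: "\<not> (\<exists>p. pre_digraph.cycle (with_proj (mk_symmetric ?T)) p \<and> 3 \<le> length p)"
    using no_long_cycle_of_rank[of ?T d] rank by (meson leD)
  have anti: "\<not> v \<rightarrow>\<^bsub>?T\<^esub> u" if "u \<rightarrow>\<^bsub>?T\<^esub> v" for u v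
  proof
    assume "v \<rightarrow>\<^bsub>?T\<^esub> u"
    with that have "d u < d v" "d v < d u" by (auto elim!: reachableE dest: rank)
    then show False by simp
  qed
  interpret M: pair_wf_digraph "mk_symmetric ?T" by (rule T.wellformed_mk_symmetric)
  have reach: "v \<in> V \<Longrightarrow> r \<rightarrow>\<^sup>*\<^bsub>?T\<^esub> v" for v
  proof (induction "d v" arbitrary: v rule: less_induct)
    case less
    show ?case
    proof (cases "v = r")
      case True
      then show ?thesis using less.prems by auto
    next
      case False
      note ev = e[OF less.prems False]
      have "tail D (e v) \<rightarrow>\<^bsub>?T\<^esub> v"
        using ev less.prems False by (force simp: arcs_ends_conv)
      then show ?thesis using less.hyps[of "tail D (e v)"] ev T.reachable_adj_trans by blast
    qed
  qed
  have "connected ?T" unfolding connected_def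
  proof (rule strongly_connectedI)
    show "verts (with_proj (mk_symmetric ?T)) \<noteq> {}" using V by auto
  next
    fix u v assume "u \<in> verts (with_proj (mk_symmetric ?T))" "v \<in> verts (with_proj (mk_symmetric ?T))"
    then have u: "r \<rightarrow>\<^sup>*\<^bsub>mk_symmetric ?T\<^esub> u" and v: "r \<rightarrow>\<^sup>*\<^bsub>mk_symmetric ?T\<^esub> v"
      using reach T.reachable_mk_symmetricI by auto
    show "u \<rightarrow>\<^sup>*\<^bsub>mk_symmetric ?T\<^esub> v"
      by (rule M.reachable_trans[OF symmetric_reachable[OF symmetric_mk_symmetric u] v])
  qed
  moreover have "in_degree ?T v = 1 \<longleftrightarrow> v \<noteq> r" if "v \<in> V" for v
  proof (cases "v = r")
    case True
    then have "a \<notin> in_arcs ?T v" for a using arc(3)[of a] by auto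
    then have "in_arcs ?T v = {}" by blast
    then show ?thesis using True by (simp add: in_degree_def)
  next
    case False
    have "a = e v" if "a \<in> in_arcs ?T v" for a using that arc(6)[of a] by auto
    moreover have "e v \<in> in_arcs ?T v" using e[OF that False] that False by simp
    ultimately have "in_arcs ?T v = {e v}" by blast
    then show ?thesis using False by (simp add: in_degree_def)
  qed
  ultimately have "out_tree ?T r"
    unfolding out_tree_def oriented_tree_def using T.digraph_axioms anti nocyc V(2) by auto
  moreover have "subgraph ?T D"
    unfolding subgraph_def compatible_def using V(1) arc(1) D.wf_digraph T.wf_digraph
    by (simp add: subset_iff)
  ultimately show ?thesis unfolding Sr_tree_def using V(3) by simp
qed

text \<open>
  Rank each vertex by its distance from \<open>r\<close>; the last arc of a shortest path serves as parent arc.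
  The resulting tree spans \<open>D\<close>.
\<close>
lemma ex_Sr_tree:
  assumes "strong_digraph D" "S \<subseteq> verts D" "r \<in> S"
  shows "\<exists>T. Sr_tree D S r T"
proof -
  have D: "digraph D" and str: "strongly_connected D"
    using assms(1) by (auto simp: strong_digraph_def)
  interpret D: digraph D by (rule D)
  define d where "d v = (LEAST m. (r, v) \<in> arcs_ends D ^^ m)" for v
  have dle: "d v \<le> m" if "(r, v) \<in> arcs_ends D ^^ m" for v m
    unfolding d_def using that by (rule Least_le)
  have "\<exists>a. a \<in> arcs D \<and> head D a = v \<and> d (tail D a) < d v"
    if v: "v \<in> verts D" "v \<noteq> r" for v
  proof -
    have "(r, v) \<in> (arcs_ends D)\<^sup>*"
      using str v assms(2,3) by (intro reachable_rtranclI) (auto simp: strongly_connected_def)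
    then have dv: "(r, v) \<in> arcs_ends D ^^ d v"
      unfolding d_def by (metis LeastI rtrancl_imp_relpow)
    with v(2) obtain m where m: "d v = Suc m" by (cases "d v") auto
    with dv obtain u where "(r, u) \<in> arcs_ends D ^^ m" "u \<rightarrow>\<^bsub>D\<^esub> v" by auto
    then show ?thesis using dle[of u m] m by (auto simp: arcs_ends_conv intro: le_imp_less_Suc)
  qed
  then obtain e where "\<And>v. v \<in> verts D \<Longrightarrow> v \<noteq> r \<Longrightarrow>
      e v \<in> arcs D \<and> head D (e v) = v \<and> d (tail D (e v)) < d v"
    by metis
  then have "Sr_tree D S r (parent_graph D (verts D) r e)"
    using assms D by (intro Sr_tree_parent_graph[where d = d]) auto
  then show ?thesis by blast
qed

section \<open>Extremal families of trees\<close>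

lemma finite_Sr_trees:
  assumes "digraph D"
  shows "finite {T. Sr_tree D S r T}"
proof -
  interpret D: digraph D by (rule assms)
  let ?G = "\<lambda>(V, A). \<lparr> verts = V, arcs = A, tail = tail D, head = head D \<rparr>"
  have "{T. Sr_tree D S r T} \<subseteq> ?G ` (Pow (verts D) \<times> Pow (arcs D))"
  proof
    fix T assume "T \<in> {T. Sr_tree D S r T}"
    then have T: "verts T \<subseteq> verts D" "arcs T \<subseteq> arcs D" "tail T = tail D" "head T = head D"
      by (simp_all add: Sr_tree_def subgraph_def compatible_def)
    show "T \<in> ?G ` (Pow (verts D) \<times> Pow (arcs D))"
      by (rule image_eqI[of _ _ "(verts T, arcs T)"]) (use T in simp_all)
  qed
  then show ?thesis by (rule finite_subset) simp
qed

lemma finite_family_cards: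
  "finite A \<Longrightarrow> finite {card F | F. F \<subseteq> A \<and> P F}"
  by (rule finite_subset[of _ "card ` Pow A"]) auto

lemma card_le_kappa_Sr:
  assumes "digraph D" "F \<subseteq> {T. Sr_tree D S r T}" "pairwise (internally_disjoint S) F"
  shows "card F \<le> kappa_Sr D S r"
  unfolding kappa_Sr_def
  by (rule Max_ge[OF finite_family_cards[OF finite_Sr_trees[OF assms(1)]]]) (use assms in blast)

lemma kappa_Sr_le_lambda_Sr:
  assumes "digraph D"
  shows "kappa_Sr D S r \<le> lambda_Sr D S r"
  unfolding kappa_Sr_def lambda_Sr_def
proof (rule Max_mono)
  show "{card F | F. F \<subseteq> {T. Sr_tree D S r T} \<and> pairwise (internally_disjoint S) F}
     \<subseteq> {card F | F. F \<subseteq> {T. Sr_tree D S r T} \<and> pairwise arc_disjoint F}"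
    by (auto simp: pairwise_def internally_disjoint_def)
  show "{card F | F. F \<subseteq> {T. Sr_tree D S r T} \<and> pairwise (internally_disjoint S) F} \<noteq> {}"
    by (auto intro!: exI[of _ "{}"] simp: pairwise_def)
qed (rule finite_family_cards[OF finite_Sr_trees[OF assms]])

text \<open>
  Sending each tree of an arc-disjoint family to its arc into \<open>s\<close> is injective.
\<close>
lemma lambda_Sr_le_in_degree:
  assumes D: "digraph D" and s: "s \<in> S" "s \<noteq> r"
  shows "lambda_Sr D S r \<le> in_degree D s"
  unfolding lambda_Sr_def
proof (rule Max.boundedI)
  show "finite {card F | F. F \<subseteq> {T. Sr_tree D S r T} \<and> pairwise arc_disjoint F}"
    by (rule finite_family_cards[OF finite_Sr_trees[OF D]])
  show "{card F | F. F \<subseteq> {T. Sr_tree D S r T} \<and> pairwise arc_disjoint F} \<noteq> {}"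
    by (auto intro!: exI[of _ "{}"] simp: pairwise_def)
next
  interpret D: digraph D by (rule D)
  fix c assume "c \<in> {card F | F. F \<subseteq> {T. Sr_tree D S r T} \<and> pairwise arc_disjoint F}"
  then obtain F where c: "c = card F" and F: "F \<subseteq> {T. Sr_tree D S r T}"
    and dis: "pairwise arc_disjoint F" by blast
  have "\<exists>a. a \<in> arcs T \<and> a \<in> in_arcs D s" if "T \<in> F" for T
  proof -
    have T: "Sr_tree D S r T" using that F by blast
    then have "card (in_arcs T s) = 1"
      using s by (auto simp: Sr_tree_def out_tree_def in_degree_def)
    then obtain a where "a \<in> in_arcs T s" by (metis card_1_singletonE insertI1)
    then show ?thesis using T by (auto simp: Sr_tree_def subgraph_def compatible_def)
  qed
  then obtain a where a: "\<And>T. T \<in> F \<Longrightarrow> a T \<in> arcs T \<and> a T \<in> in_arcs D s" by metis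
  have "inj_on a F"
  proof (rule inj_onI, rule ccontr)
    fix T U assume "T \<in> F" "U \<in> F" "a T = a U" "T \<noteq> U"
    then show False using a[of T] a[of U] dis
      by (auto simp: pairwise_def arc_disjoint_def)
  qed
  then have "card F \<le> card (in_arcs D s)"
    using a by (intro card_inj_on_le) auto
  then show "c \<le> in_degree D s" by (simp add: c in_degree_def)
qed

lemma one_le_kappa_Sr:
  assumes "strong_digraph D" "S \<subseteq> verts D" "r \<in> S"
  shows "1 \<le> kappa_Sr D S r"
proof -
  obtain T where "Sr_tree D S r T" using ex_Sr_tree[OF assms] by blast
  then show ?thesis using card_le_kappa_Sr[of D "{T}" S r] assms(1)
    by (simp add: strong_digraph_def)
qed

section \<open>Minimising over terminal sets\<close>

lemma
  fixes f :: "'a set \<Rightarrow> 'a \<Rightarrow> nat"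
  assumes "finite V" "1 \<le> k" "k \<le> card V"
  shows Min_terminals_ge_iff:
      "m \<le> Min {f S r | S r. S \<subseteq> V \<and> card S = k \<and> r \<in> S} \<longleftrightarrow>
        (\<forall>S r. S \<subseteq> V \<and> card S = k \<and> r \<in> S \<longrightarrow> m \<le> f S r)"
    and Min_terminals_le:
      "S \<subseteq> V \<Longrightarrow> card S = k \<Longrightarrow> r \<in> S \<Longrightarrow>
        Min {f S r | S r. S \<subseteq> V \<and> card S = k \<and> r \<in> S} \<le> f S r"
proof -
  let ?A = "{f S r | S r. S \<subseteq> V \<and> card S = k \<and> r \<in> S}"
  have fin: "finite ?A"
    by (rule finite_subset[of _ "(\<lambda>(S, r). f S r) ` (Pow V \<times> V)"]) (use assms(1) in auto)
  obtain R where R: "R \<subseteq> V" "card R = k" using obtain_subset_with_card_n[OF assms(3)] by blast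
  then obtain x where "x \<in> R" using assms(2) by fastforce
  with R have "f R x \<in> ?A" by blast
  then have ne: "?A \<noteq> {}" by blast
  show "m \<le> Min ?A \<longleftrightarrow> (\<forall>S r. S \<subseteq> V \<and> card S = k \<and> r \<in> S \<longrightarrow> m \<le> f S r)"
    unfolding Min_ge_iff[OF fin ne] by blast
  show "S \<subseteq> V \<Longrightarrow> card S = k \<Longrightarrow> r \<in> S \<Longrightarrow> Min ?A \<le> f S r"
    using fin by (intro Min_le) blast+
qed

lemma ex_terminals:
  assumes "finite V" "2 \<le> k" "k \<le> card V" "s \<in> V"
  shows "\<exists>S r. S \<subseteq> V \<and> card S = k \<and> r \<in> S \<and> s \<in> S \<and> s \<noteq> r"
proof -
  have "k - 1 \<le> card (V - {s})" using assms by simp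
  then obtain R where R: "R \<subseteq> V - {s}" "card R = k - 1" "finite R"
    by (rule obtain_subset_with_card_n)
  then obtain r where "r \<in> R" using assms(2) by fastforce
  moreover have "card (insert s R) = k" using R assms(2) by (subst card_insert_disjoint) auto
  ultimately show ?thesis using R assms(4) by (intro exI[of _ "insert s R"] exI[of _ r]) auto
qed

lemma kappa_le_lambda:
  assumes D: "digraph D" and k: "1 \<le> k" "k \<le> card (verts D)"
  shows "kappa k D \<le> lambda k D"
proof -
  interpret D: digraph D by (rule D)
  show ?thesis
    unfolding lambda_def Min_terminals_ge_iff[OF D.finite_verts k]
  proof (intro allI impI, elim conjE)
    fix S r assume S: "S \<subseteq> verts D" "card S = k" "r \<in> S"
    have "kappa k D \<le> kappa_Sr D S r"
      unfolding kappa_def by (rule Min_terminals_le[OF D.finite_verts k S])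
    also have "\<dots> \<le> lambda_Sr D S r" by (rule kappa_Sr_le_lambda_Sr[OF D])
    finally show "kappa k D \<le> lambda_Sr D S r" .
  qed
qed

lemma one_le_kappa:
  assumes D: "strong_digraph D" and k: "1 \<le> k" "k \<le> card (verts D)"
  shows "1 \<le> kappa k D"
proof -
  interpret D: digraph D using D by (simp add: strong_digraph_def)
  show ?thesis unfolding kappa_def Min_terminals_ge_iff[OF D.finite_verts k]
    using one_le_kappa_Sr[OF D] by blast
qed

lemma lambda_le_in_degree:
  assumes D: "digraph D" and k: "2 \<le> k" "k \<le> card (verts D)" and s: "s \<in> verts D"
  shows "lambda k D \<le> in_degree D s"
proof -
  interpret D: digraph D by (rule D)
  obtain S r where S: "S \<subseteq> verts D" "card S = k" "r \<in> S" and s': "s \<in> S" "s \<noteq> r"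
    using ex_terminals[OF D.finite_verts k s] by (elim exE conjE)
  have "1 \<le> k" using k by simp
  then have "lambda k D \<le> lambda_Sr D S r"
    unfolding lambda_def by (rule Min_terminals_le[OF D.finite_verts _ k(2) S])
  also have "\<dots> \<le> in_degree D s" by (rule lambda_Sr_le_in_degree[OF D s'])
  finally show ?thesis .
qed

section \<open>In-degrees and complete digraphs\<close>

lemma (in digraph) card_in_neighbours:
  "card (tail G ` in_arcs G s) = in_degree G s"
  unfolding in_degree_def
  by (intro card_image inj_onI no_multi_arcs) (simp_all add: arc_to_ends_def)

lemma (in digraph) in_neighbours_subset:
  "tail G ` in_arcs G s \<subseteq> verts G - {s}"
proof
  fix u assume "u \<in> tail G ` in_arcs G s"
  then obtain a where a: "u = tail G a" "a \<in> arcs G" "head G a = s" by auto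
  then show "u \<in> verts G - {s}" using no_loops[OF a(2)] by simp
qed

lemma (in digraph) in_degree_le:
  assumes "s \<in> verts G"
  shows "in_degree G s \<le> card (verts G) - 1"
  using card_mono[OF _ in_neighbours_subset, of s] assms by (simp add: card_in_neighbours)

lemma (in digraph) complete_digraphI:
  assumes "\<And>u v. u \<in> verts G \<Longrightarrow> v \<in> verts G \<Longrightarrow> u \<noteq> v \<Longrightarrow> u \<rightarrow> v"
  shows "complete_digraph (card (verts G)) G"
proof -
  have ends: "arcs_ends G = {(u, v). (u, v) \<in> verts G \<times> verts G \<and> u \<noteq> v}"
    using assms adj_not_same by (auto dest: adj_in_verts)
  then have "symmetric G" unfolding symmetric_def by (auto intro: symI)
  then show ?thesis unfolding complete_digraph_def using ends graphI by blast
qed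

text \<open>
  The in-neighbours of a vertex \<open>s\<close> lie among the other vertices, so maximal in-degree leaves no
  vertex out.
\<close>
lemma (in digraph) complete_digraph_of_in_degrees:
  assumes "\<And>s. s \<in> verts G \<Longrightarrow> in_degree G s = card (verts G) - 1"
  shows "complete_digraph (card (verts G)) G"
proof -
  have "u \<rightarrow> s" if "u \<in> verts G" "s \<in> verts G" "u \<noteq> s" for u s
  proof -
    have "tail G ` in_arcs G s = verts G - {s}"
      using that assms
      by (intro card_subset_eq[OF _ in_neighbours_subset]) (simp_all add: card_in_neighbours)
    then have "u \<in> tail G ` in_arcs G s" using that by simp
    then show ?thesis by (auto simp: arcs_ends_conv)
  qed
  then show ?thesis by (rule complete_digraphI)
qed

lemma complete_digraph_iso_complete_dg:
  assumes "complete_digraph n D"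
  shows "digraph_iso D (complete_dg n)"
proof -
  interpret D: graph D using assms by (simp add: complete_digraph_def)
  have ends: "arcs_ends D = {(u, v). (u, v) \<in> verts D \<times> verts D \<and> u \<noteq> v}"
    and card: "card (verts D) = n" using assms by (auto simp: complete_digraph_def)
  obtain f where f: "bij_betw f (verts D) {0..<n}"
    using ex_bij_betw_finite_nat[OF D.finite_verts] card by blast
  have inj: "inj_on f (verts D)" and im: "f ` verts D = {0..<n}"
    using f by (auto simp: bij_betw_def)
  define h where "h = \<lparr> iso_verts = f, iso_arcs = (\<lambda>a. (f (tail D a), f (head D a))),
      iso_head = snd, iso_tail = fst \<rparr>"
  have "inj_on (\<lambda>a. (f (tail D a), f (head D a))) (arcs D)"
    using inj by (auto intro!: inj_onI D.no_multi_arcs simp: arc_to_ends_def inj_on_eq_iff)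
  then have "D.digraph_isomorphism h"
    unfolding D.digraph_isomorphism_def h_def using inj D.wf_digraph by simp
  moreover have "(\<lambda>a. (f (tail D a), f (head D a))) ` arcs D
      = {(u, v). u < n \<and> v < n \<and> u \<noteq> v}"
  proof -
    have "(\<lambda>a. (f (tail D a), f (head D a))) ` arcs D = (\<lambda>(u, v). (f u, f v)) ` arcs_ends D"
      unfolding arcs_ends_conv by (auto simp: image_image)
    also have "\<dots> = {(u, v). u \<in> f ` verts D \<and> v \<in> f ` verts D \<and> u \<noteq> v}"
      unfolding ends using inj by (auto simp: image_iff dest: inj_onD)
    finally show ?thesis by (simp add: im)
  qed
  then have "complete_dg n = app_iso h D"
    using im by (simp add: complete_dg_def app_iso_def h_def with_proj_def)
  ultimately show ?thesis unfolding digraph_iso_def by blast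
qed

lemma complete_digraph_of_iso:
  assumes D: "digraph D" and iso: "digraph_iso D (complete_dg n)"
  shows "complete_digraph n D"
proof -
  interpret D: digraph D by (rule D)
  obtain h where h: "D.digraph_isomorphism h" and eq: "complete_dg n = app_iso h D"
    using iso unfolding digraph_iso_def by blast
  have inj: "inj_on (iso_verts h) (verts D)" using h by (simp add: D.digraph_isomorphism_def)
  have tl: "iso_tail h = fst" and hd: "iso_head h = snd"
    and vs: "iso_verts h ` verts D = {0..<n}"
    and as: "iso_arcs h ` arcs D = {(u, v). u < n \<and> v < n \<and> u \<noteq> v}"
    using arg_cong[OF eq, of tail] arg_cong[OF eq, of head]
      arg_cong[OF eq, of verts] arg_cong[OF eq, of arcs]
    by (simp_all add: complete_dg_def)
  have card: "card (verts D) = n" using card_image[OF inj] vs by simp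
  have "u \<rightarrow>\<^bsub>D\<^esub> v" if uv: "u \<in> verts D" "v \<in> verts D" "u \<noteq> v" for u v
  proof -
    have "(iso_verts h u, iso_verts h v) \<in> iso_arcs h ` arcs D"
      unfolding as using uv vs inj by (auto dest: inj_onD)
    then obtain a where a: "a \<in> arcs D" "iso_arcs h a = (iso_verts h u, iso_verts h v)" by force
    then have "tail D a = u" "head D a = v"
      using D.iso_verts_tail[OF h a(1)] D.iso_verts_head[OF h a(1)] tl hd uv inj a
      by (auto simp: inj_on_eq_iff)
    then show ?thesis using a by (auto simp: arcs_ends_conv)
  qed
  then show ?thesis using D.complete_digraphI card by simp
qed

text \<open>
  The tree with centre \<open>c\<close> has the arc \<open>rc\<close> and the arcs \<open>cv\<close> for \<open>v \<in> S - {r, c}\<close>. Trees with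
  different centres share no arc, because the tail of an arc together with its head determines the
  centre: it is the head if the tail is \<open>r\<close>, and the tail otherwise. The vertex set is
  \<open>S \<union> {c}\<close>, so two of them meet exactly in \<open>S\<close>, whether or not the centres belong to \<open>S\<close>.
\<close>
lemma kappa_Sr_complete:
  assumes K: "complete_digraph n D" and S: "S \<subseteq> verts D" "r \<in> S"
  shows "n - 1 \<le> kappa_Sr D S r"
proof -
  interpret D: graph D using K by (simp add: complete_digraph_def)
  have card: "card (verts D) = n" using K by (simp add: complete_digraph_def)
  have "\<exists>a. a \<in> arcs D \<and> tail D a = u \<and> head D a = v"
    if "u \<in> verts D" "v \<in> verts D" "u \<noteq> v" for u v
  proof -
    have "u \<rightarrow>\<^bsub>D\<^esub> v" using K that by (simp add: complete_digraph_def)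
    then show ?thesis by blast
  qed
  then obtain a where a: "\<And>u v. u \<in> verts D \<Longrightarrow> v \<in> verts D \<Longrightarrow> u \<noteq> v \<Longrightarrow>
      a u v \<in> arcs D \<and> tail D (a u v) = u \<and> head D (a u v) = v"
    by metis
  define p where "p c v = (if v = c then a r c else a c v)" for c v
  define T where "T c = parent_graph D (insert c S) r (p c)" for c
  have r: "r \<in> verts D" using S by auto
  have p: "p c v \<in> arcs D" "tail D (p c v) = (if v = c then r else c)" "head D (p c v) = v"
    if "c \<in> verts D" "c \<noteq> r" "v \<in> verts D" for c v
    using a[OF r that(1)] a[OF that(1,3)] that(2) by (cases "v = c"; simp add: p_def)+
  have tree: "Sr_tree D S r (T c)" if c: "c \<in> verts D" "c \<noteq> r" for c
    unfolding T_def
  proof (rule Sr_tree_parent_graph[where d = "\<lambda>v. if v = r then 0 else if v = c then 1 else 2"])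
    fix v assume v: "v \<in> insert c S" "v \<noteq> r"
    then have "v \<in> verts D" using S c by auto
    then show "p c v \<in> arcs D \<and> head D (p c v) = v \<and> tail D (p c v) \<in> insert c S \<and>
        (if tail D (p c v) = r then 0 else if tail D (p c v) = c then 1 else 2)
          < (if v = r then 0 else if v = c then 1 else (2::nat))"
      using p[OF c] v c S(2) by simp
  qed (use S c D.digraph_axioms in auto)
  have dis: "internally_disjoint S (T b) (T c)"
    if bc: "b \<in> verts D" "b \<noteq> r" "c \<in> verts D" "c \<noteq> r" "b \<noteq> c" for b c
  proof -
    have "p b u \<noteq> p c v" if "u \<in> insert b S - {r}" "v \<in> insert c S - {r}" for u v
    proof -
      have uv: "u \<in> verts D" "v \<in> verts D" "u \<noteq> r" "v \<noteq> r" using that S bc by auto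
      show ?thesis
      proof
        assume eq: "p b u = p c v"
        have "u = v" using p(3)[OF bc(1,2) uv(1)] p(3)[OF bc(3,4) uv(2)] eq by simp
        moreover have "(if u = b then r else b) = (if v = c then r else c)"
          using p(2)[OF bc(1,2) uv(1)] p(2)[OF bc(3,4) uv(2)] eq by simp
        ultimately show False using bc by (simp split: if_splits)
      qed
    qed
    then have "arc_disjoint (T b) (T c)" unfolding arc_disjoint_def T_def by auto
    moreover have "verts (T b) \<inter> verts (T c) = S" using bc by (auto simp: T_def)
    ultimately show ?thesis by (simp add: internally_disjoint_def)
  qed
  have ne: "arcs (T c) \<noteq> {}" if "c \<noteq> r" for c using that by (auto simp: T_def)
  \<comment> \<open>The maximum is over sets of trees, so the count needs different centres to give different
    trees; a tree that has an arc is not arc-disjoint from itself.\<close>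
  have inj: "inj_on T (verts D - {r})"
  proof (rule inj_onI, rule ccontr)
    fix b c assume "b \<in> verts D - {r}" "c \<in> verts D - {r}" "T b = T c" "b \<noteq> c"
    then show False using dis[of b c] ne[of c]
      by (auto simp: internally_disjoint_def arc_disjoint_def)
  qed
  have "card (T ` (verts D - {r})) \<le> kappa_Sr D S r"
  proof (rule card_le_kappa_Sr)
    show "T ` (verts D - {r}) \<subseteq> {T. Sr_tree D S r T}" using tree by auto
    show "pairwise (internally_disjoint S) (T ` (verts D - {r}))"
      unfolding pairwise_def using dis by auto
  qed (rule D.digraph_axioms)
  then show ?thesis using card_image[OF inj] r card by simp
qed

section \<open>Bounds and sharpness\<close>

lemma lambda_le:
  assumes D: "digraph D" and k: "2 \<le> k" "k \<le> card (verts D)"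
  shows "lambda k D \<le> card (verts D) - 1"
proof -
  obtain s where s: "s \<in> verts D" using k by fastforce
  then show ?thesis using lambda_le_in_degree[OF D k s] digraph.in_degree_le[OF D s] by simp
qed

lemma complete_if_lambda_max:
  assumes D: "digraph D" and k: "2 \<le> k" "k \<le> card (verts D)"
    and max: "lambda k D = card (verts D) - 1"
  shows "complete_digraph (card (verts D)) D"
  using lambda_le_in_degree[OF D k] digraph.in_degree_le[OF D] max
  by (intro digraph.complete_digraph_of_in_degrees[OF D] order_antisym) auto

lemma kappa_complete_ge:
  assumes K: "complete_digraph n D" and k: "2 \<le> k" "k \<le> n"
  shows "n - 1 \<le> kappa k D"
proof -
  interpret D: graph D using K by (simp add: complete_digraph_def)
  have "card (verts D) = n" using K by (simp add: complete_digraph_def)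
  then show ?thesis
    unfolding kappa_def using k kappa_Sr_complete[OF K]
    by (subst Min_terminals_ge_iff[OF D.finite_verts]) auto
qed

text \<open>
  The chain \<open>\<kappa>\<^sub>k \<le> \<lambda>\<^sub>k \<le> n - 1\<close> lets one argument settle both equivalences: a maximal \<open>\<lambda>\<^sub>k\<close> forces
  completeness, and completeness forces a maximal \<open>\<kappa>\<^sub>k\<close>.
\<close>
lemma kappa_lambda_max_iff:
  assumes D: "digraph D" and k: "2 \<le> k" "k \<le> n" and n: "card (verts D) = n"
  shows "kappa k D = n - 1 \<longleftrightarrow> digraph_iso D (complete_dg n)"
    and "lambda k D = n - 1 \<longleftrightarrow> digraph_iso D (complete_dg n)"
proof -
  have le: "kappa k D \<le> lambda k D" "lambda k D \<le> n - 1"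
    using kappa_le_lambda[OF D, of k] lambda_le[OF D, of k] k n by auto
  have "digraph_iso D (complete_dg n)" if "lambda k D = n - 1"
    using complete_if_lambda_max[OF D, of k] complete_digraph_iso_complete_dg that k n by metis
  moreover have "n - 1 \<le> kappa k D" if "digraph_iso D (complete_dg n)"
    using kappa_complete_ge[OF complete_digraph_of_iso[OF D that] k] .
  ultimately show "kappa k D = n - 1 \<longleftrightarrow> digraph_iso D (complete_dg n)"
    and "lambda k D = n - 1 \<longleftrightarrow> digraph_iso D (complete_dg n)"
    using le by (auto intro: order_antisym)
qed

lemma strong_digraph_if_hub:
  assumes D: "digraph D" and c: "c \<in> verts D"
    and hub: "\<And>v. v \<in> verts D \<Longrightarrow> v \<noteq> c \<Longrightarrow> c \<rightarrow>\<^bsub>D\<^esub> v \<and> v \<rightarrow>\<^bsub>D\<^esub> c"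
  shows "strong_digraph D"
proof -
  interpret D: digraph D by (rule D)
  have "c \<rightarrow>\<^sup>*\<^bsub>D\<^esub> v \<and> v \<rightarrow>\<^sup>*\<^bsub>D\<^esub> c" if "v \<in> verts D" for v
    using hub[OF that] c by (cases "v = c") auto
  then show ?thesis unfolding strong_digraph_def
    using c D D.reachable_trans by (blast intro: strongly_connectedI)
qed

lemma strong_complete_dg:
  assumes "1 \<le> n"
  shows "strong_digraph (complete_dg n)"
proof -
  interpret K: graph "complete_dg n"
    using complete_digraph_complete_dg[of n] by (simp add: complete_digraph_def)
  show ?thesis using assms
    by (intro strong_digraph_if_hub[OF K.digraph_axioms, of 0]) (auto simp: complete_dg_def)
qed

definition bidirected_star :: "nat \<Rightarrow> (nat, nat \<times> nat) pre_digraph" where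
  "bidirected_star n = with_proj \<lparr> pverts = {0..<n},
     parcs = {(u, v). u < n \<and> v < n \<and> u \<noteq> v \<and> (u = 0 \<or> v = 0)} \<rparr>"

lemma strong_bidirected_star:
  assumes "1 \<le> n"
  shows "strong_digraph (bidirected_star n)"
proof -
  have "finite {(u, v). u < n \<and> v < n \<and> u \<noteq> v \<and> (u = 0 \<or> v = 0)}"
    by (rule finite_subset[of _ "{0..<n} \<times> {0..<n}"]) auto
  then have "digraph (bidirected_star n)"
    by unfold_locales (auto simp: bidirected_star_def arc_to_ends_def)
  then show ?thesis
    by (rule strong_digraph_if_hub[of _ 0]) (use assms in \<open>auto simp: bidirected_star_def\<close>)
qed

lemma in_degree_bidirected_star:
  assumes "2 \<le> n"
  shows "in_degree (bidirected_star n) 1 = 1"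
proof -
  have "in_arcs (bidirected_star n) 1 = {(0, 1)}"
    using assms by (auto simp: bidirected_star_def)
  then show ?thesis by (simp add: in_degree_def)
qed

theorem theorem6p3:
  fixes n k :: nat
  assumes "2 \<le> k" and "k \<le> n"
  shows
    "(\<forall>D :: ('a,'b) pre_digraph. strong_digraph D \<and> card (verts D) = n \<longrightarrow>
        (1 \<le> kappa k D \<and> kappa k D \<le> n - 1) \<and>
        (1 \<le> lambda k D \<and> lambda k D \<le> n - 1) \<and>
        (kappa k D = n - 1 \<longleftrightarrow> digraph_iso D (complete_dg n)) \<and>
        (lambda k D = n - 1 \<longleftrightarrow> digraph_iso D (complete_dg n))) \<and>
     (\<exists>D :: (nat, nat \<times> nat) pre_digraph.
        strong_digraph D \<and> card (verts D) = n \<and> kappa k D = 1) \<and>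
     (\<exists>D :: (nat, nat \<times> nat) pre_digraph.
        strong_digraph D \<and> card (verts D) = n \<and> kappa k D = n - 1) \<and>
     (\<exists>D :: (nat, nat \<times> nat) pre_digraph.
        strong_digraph D \<and> card (verts D) = n \<and> lambda k D = 1) \<and>
     (\<exists>D :: (nat, nat \<times> nat) pre_digraph.
        strong_digraph D \<and> card (verts D) = n \<and> lambda k D = n - 1)"
proof (intro conjI)
  show "\<forall>D :: ('a,'b) pre_digraph. strong_digraph D \<and> card (verts D) = n \<longrightarrow>
        (1 \<le> kappa k D \<and> kappa k D \<le> n - 1) \<and>
        (1 \<le> lambda k D \<and> lambda k D \<le> n - 1) \<and>
        (kappa k D = n - 1 \<longleftrightarrow> digraph_iso D (complete_dg n)) \<and>
        (lambda k D = n - 1 \<longleftrightarrow> digraph_iso D (complete_dg n))"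
  proof (intro allI impI)
    fix D :: "('a,'b) pre_digraph"
    assume "strong_digraph D \<and> card (verts D) = n"
    then have sD: "strong_digraph D" and n: "card (verts D) = n" by auto
    then have D: "digraph D" by (simp add: strong_digraph_def)
    have "1 \<le> kappa k D" "kappa k D \<le> lambda k D" "lambda k D \<le> n - 1"
      using one_le_kappa[OF sD, of k] kappa_le_lambda[OF D, of k] lambda_le[OF D, of k] assms n
      by auto
    then show "(1 \<le> kappa k D \<and> kappa k D \<le> n - 1) \<and>
        (1 \<le> lambda k D \<and> lambda k D \<le> n - 1) \<and>
        (kappa k D = n - 1 \<longleftrightarrow> digraph_iso D (complete_dg n)) \<and>
        (lambda k D = n - 1 \<longleftrightarrow> digraph_iso D (complete_dg n))"
      using kappa_lambda_max_iff[OF D assms n] by linarith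
  qed
next
  let ?B = "bidirected_star n"
  have sB: "strong_digraph ?B" using assms by (intro strong_bidirected_star) simp
  then have B: "digraph ?B" by (simp add: strong_digraph_def)
  have n: "card (verts ?B) = n" by (simp add: bidirected_star_def)
  have "1 \<in> verts ?B" using assms by (simp add: bidirected_star_def)
  then have "lambda k ?B \<le> 1"
    using lambda_le_in_degree[OF B, of k 1] in_degree_bidirected_star[of n] assms n by simp
  moreover have "1 \<le> kappa k ?B" "kappa k ?B \<le> lambda k ?B"
    using one_le_kappa[OF sB, of k] kappa_le_lambda[OF B, of k] assms n by auto
  ultimately have "kappa k ?B = 1" "lambda k ?B = 1" by auto
  then show
    "\<exists>D :: (nat, nat \<times> nat) pre_digraph. strong_digraph D \<and> card (verts D) = n \<and> kappa k D = 1"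
    "\<exists>D :: (nat, nat \<times> nat) pre_digraph. strong_digraph D \<and> card (verts D) = n \<and> lambda k D = 1"
    using sB n by blast+
next
  let ?K = "complete_dg n"
  have sK: "strong_digraph ?K" using assms by (intro strong_complete_dg) simp
  then have K: "digraph ?K" by (simp add: strong_digraph_def)
  have n: "card (verts ?K) = n" by (simp add: complete_dg_def)
  have "digraph_iso ?K ?K"
    by (rule complete_digraph_iso_complete_dg[OF complete_digraph_complete_dg])
  then have "kappa k ?K = n - 1" "lambda k ?K = n - 1"
    using kappa_lambda_max_iff[OF K assms n] by auto
  then show
    "\<exists>D :: (nat, nat \<times> nat) pre_digraph. strong_digraph D \<and> card (verts D) = n \<and> kappa k D = n - 1"
    "\<exists>D :: (nat, nat \<times> nat) pre_digraph. strong_digraph D \<and> card (verts D) = n \<and> lambda k D = n - 1"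
    using sK n by blast+
qed

end
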